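(* Let $G$ be a finite group and let $\Gamma=\mathcal{P}^\ast(G)$. An edge $e=xy$ of $\Gamma$ is a cut edge of $\Gamma$ if and only if $d^-(x)=d^+(x)=1$, where $d^-(x)$ and $d^+(x)$ are the in-degree and out-degree of $x$ in the directed graph $\vec{\mathcal{P}}^\ast(G)$.
   Context: For a group $G$, $\mathcal{P}^\ast(G)$ is the simple undirected graph with vertex set $G\setminus\{1\}$ in which two distinct vertices $x,y$ are adjacent if and only if $y=x^m$ or $x=y^m$ for some positive integer $m$. The directed graph $\vec{\mathcal{P}}^\ast(G)$ has vertex set $G\setminus\{1\}$ and, for distinct $x,y$, an arc from $x$ to $y$ if and only if $y=x^m$ for some positive integer $m$ (no loops). An edge $e$ of a graph $\Gamma$ is a cut edge if $c(\Gamma-e)=c(\Gamma)+1$, where $c$ denotes the number of connected components and $\Gamma-e$ is $\Gamma$ with the edge $e$ deleted. *)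

theory Defs
  imports "HOL-Algebra.Group" "Graph_Theory.Digraph_Component"
begin

definition proper_power_digraph :: "('a, 'b) monoid_scheme \<Rightarrow> 'a pair_pre_digraph" where
  "proper_power_digraph G =
     \<lparr> pverts = carrier G - {\<one>\<^bsub>G\<^esub>},
       parcs = {(x, y). x \<in> carrier G - {\<one>\<^bsub>G\<^esub>} \<and> y \<in> carrier G - {\<one>\<^bsub>G\<^esub>} \<and> x \<noteq> y
                  \<and> (\<exists>m::nat. m > 0 \<and> y = x [^]\<^bsub>G\<^esub> m)} \<rparr>"

text \<open>
  Undirected simple graphs are symmetric loopfree digraphs, as in the locale
  \<^locale>\<open>pair_graph\<close>: the edge joining \<open>x\<close> and \<open>y\<close> is the pair of arcs \<open>(x, y)\<close>, \<open>(y, x)\<close>.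
\<close>

definition proper_power_graph :: "('a, 'b) monoid_scheme \<Rightarrow> 'a pair_pre_digraph" where
  "proper_power_graph G =
     \<lparr> pverts = carrier G - {\<one>\<^bsub>G\<^esub>},
       parcs = {(x, y). x \<in> carrier G - {\<one>\<^bsub>G\<^esub>} \<and> y \<in> carrier G - {\<one>\<^bsub>G\<^esub>} \<and> x \<noteq> y
                  \<and> (\<exists>m::nat. m > 0 \<and> (y = x [^]\<^bsub>G\<^esub> m \<or> x = y [^]\<^bsub>G\<^esub> m))} \<rparr>"

lemma pair_digraph_proper_power_digraph:
  assumes "finite (carrier G)"
  shows "pair_digraph (proper_power_digraph G)"
proof
  show "finite (parcs (proper_power_digraph G))"
    by (rule finite_subset[of _ "carrier G \<times> carrier G"])
      (use assms in \<open>auto simp: proper_power_digraph_def\<close>)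
qed (use assms in \<open>auto simp: proper_power_digraph_def\<close>)

lemma pair_graph_proper_power_graph:
  assumes "finite (carrier G)"
  shows "pair_graph (proper_power_graph G)"
proof
  show "finite (parcs (proper_power_graph G))"
    by (rule finite_subset[of _ "carrier G \<times> carrier G"])
      (use assms in \<open>auto simp: proper_power_graph_def\<close>)
  show "symmetric (with_proj (proper_power_graph G))"
    by (auto simp: symmetric_def sym_def proper_power_graph_def)
qed (use assms in \<open>auto simp: proper_power_graph_def\<close>)

text \<open>
  On a symmetric digraph the strongly connected components are the connected components
  of the undirected graph.
\<close>

definition num_components :: "'a pair_pre_digraph \<Rightarrow> nat" where
  "num_components \<Gamma> = card (pre_digraph.sccs (with_proj \<Gamma>))"

definition del_edge :: "'a pair_pre_digraph \<Rightarrow> 'a \<Rightarrow> 'a \<Rightarrow> 'a pair_pre_digraph" where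
  "del_edge \<Gamma> x y = \<lparr> pverts = pverts \<Gamma>, parcs = parcs \<Gamma> - {(x, y), (y, x)} \<rparr>"

definition cut_edge :: "'a pair_pre_digraph \<Rightarrow> 'a \<Rightarrow> 'a \<Rightarrow> bool" where
  "cut_edge \<Gamma> x y \<longleftrightarrow>
     (x, y) \<in> parcs \<Gamma> \<and> num_components (del_edge \<Gamma> x y) = num_components \<Gamma> + 1"

end

(*
  An edge on a triangle is not a cut edge, whereas the only edge at a vertex of degree one is.
  If x and x^-1 differ, then they are adjacent in the power graph and have the same further
  neighbours. An involution has only itself and 1 as powers, so at least one end of an edge xy
  differs from its inverse. A cut edge xy therefore has y = x^-1, and x has no other neighbour.
  Conversely, in-degree and out-degree 1 force x^-1 to be the only neighbour of x.
*)
theory Submission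
  imports Defs "HOL-Algebra.Multiplicative_Group"
begin

section \<open>Counting components and detecting cut edges in finite graphs\<close>

text \<open>Symmetry makes reachability an equivalence relation, so strong components are its
  classes. Deleting an edge can then be studied through closures of plain relations.\<close>

lemma num_components_conv_rtrancl:
  assumes "pair_graph \<Gamma>"
  shows "num_components \<Gamma> = card ((\<lambda>u. (parcs \<Gamma>)\<^sup>* `` {u}) ` pverts \<Gamma>)"
proof -
  interpret pair_graph \<Gamma> by fact
  have scc: "scc_of u = (parcs \<Gamma>)\<^sup>* `` {u}" if "u \<in> pverts \<Gamma>" for u
    using that reachable_conv'[of u] symmetric_reachable' by (auto simp: scc_of_def)
  have "num_components \<Gamma> = card sccs_verts"
    by (simp add: num_components_def card_sccs_verts)
  also have "\<dots> = card ((\<lambda>u. (parcs \<Gamma>)\<^sup>* `` {u}) ` pverts \<Gamma>)"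
    using scc by (simp add: sccs_verts_conv_scc_of cong: image_cong)
  finally show ?thesis .
qed

lemma del_edge_simps [simp]:
  "pverts (del_edge \<Gamma> x y) = pverts \<Gamma>"
  "parcs (del_edge \<Gamma> x y) = parcs \<Gamma> - {(x, y), (y, x)}"
  by (simp_all add: del_edge_def)

lemma pair_graph_del_edge:
  assumes "pair_graph \<Gamma>"
  shows "pair_graph (del_edge \<Gamma> x y)"
proof -
  interpret pair_graph \<Gamma> by fact
  show ?thesis
  proof
    show "symmetric (with_proj (del_edge \<Gamma> x y))"
      using arcs_symmetric by (auto simp: symmetric_def sym_def)
  qed (auto dest: in_arcsD1 in_arcsD2 no_loops')
qed

text \<open>The detour through \<open>z\<close> replaces the deleted edge in both directions, so the
  reachability relation does not change.\<close>

lemma not_cut_edge_triangle: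
  assumes "pair_graph \<Gamma>" "(x, y) \<in> parcs \<Gamma>" "(x, z) \<in> parcs \<Gamma>" "(z, y) \<in> parcs \<Gamma>"
  shows "\<not> cut_edge \<Gamma> x y"
proof -
  interpret pair_graph \<Gamma> by fact
  let ?R' = "parcs \<Gamma> - {(x, y), (y, x)}"
  have "(x, z) \<in> ?R'" "(z, y) \<in> ?R'" "(y, z) \<in> ?R'" "(z, x) \<in> ?R'"
    using assms arcs_symmetric no_loops' by auto
  then have "(x, y) \<in> ?R'\<^sup>*" "(y, x) \<in> ?R'\<^sup>*"
    by (meson r_into_rtrancl rtrancl_into_rtrancl)+
  then have "?R'\<^sup>* = (parcs \<Gamma>)\<^sup>*"
    by (intro rtrancl_subset[symmetric]) auto
  then show ?thesis
    using assms(1) by (simp add: cut_edge_def num_components_conv_rtrancl pair_graph_del_edge)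
qed

text \<open>Deleting the only edge at \<open>x\<close> removes \<open>x\<close> from its component,
  leaves the other components alone and creates the new component \<open>{x}\<close>.\<close>

lemma cut_edge_pendant:
  assumes "pair_graph \<Gamma>" and nb: "\<And>v. (x, v) \<in> parcs \<Gamma> \<longleftrightarrow> v = y"
  shows "cut_edge \<Gamma> x y"
proof -
  interpret pair_graph \<Gamma> by fact
  define R where "R = parcs \<Gamma>"
  define R' where "R' = R - {(x, y), (y, x)}"
  define C where "C = (\<lambda>u. R\<^sup>* `` {u})"
  define C' where "C' = (\<lambda>u. R'\<^sup>* `` {u})"
  let ?V = "pverts \<Gamma>" and ?del = "\<lambda>S. S - {x}"
  have symR: "sym R"
    unfolding R_def by (auto intro: symI arcs_symmetric)
  have xy: "(x, y) \<in> R" "(y, x) \<in> R"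
    using nb arcs_symmetric by (auto simp: R_def)
  have V: "x \<in> ?V" "y \<in> ?V - {x}"
    using xy in_arcsD1 in_arcsD2 no_loops' by (auto simp: R_def)
  have into_x: "v = y" if "(v, x) \<in> R" for v
    using that nb arcs_symmetric by (auto simp: R_def)
  have C_eq: "C u = C v" if "(u, v) \<in> R\<^sup>*" for u v
    using that symD[OF sym_rtrancl[OF symR] that] by (auto simp: C_def)
  have not_into_x: "v = x" if "(v, x) \<in> R'\<^sup>*" for v
    using that by (cases rule: rtranclE) (auto dest: into_x simp: R'_def)
  have C'_x: "C' x = {x}"
  proof -
    have "v = x" if "(x, v) \<in> R'\<^sup>*" for v
      using that by (cases rule: converse_rtranclE) (auto simp: nb R'_def R_def)
    then show ?thesis by (auto simp: C'_def)
  qed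
  have C'_other: "C' u = C u - {x}" if "u \<noteq> x" for u
  proof -
    \<comment> \<open>A walk enters and leaves \<open>x\<close> only through \<open>y\<close>. While
      it sits at \<open>x\<close>, the invariant therefore records that \<open>y\<close> is
      reachable without the deleted edge.\<close>
    have "(v \<noteq> x \<longrightarrow> (u, v) \<in> R'\<^sup>*) \<and> (v = x \<longrightarrow> (u, y) \<in> R'\<^sup>*)" if "(u, v) \<in> R\<^sup>*" for v
      using that
    proof induction
      case base
      then show ?case using \<open>u \<noteq> x\<close> by simp
    next
      case (step v w)
      consider "w = x" "v = y" | "w \<noteq> x" "v = x" "w = y" | "w \<noteq> x" "v \<noteq> x"
        using step.hyps into_x nb by (auto simp: R_def)
      then show ?case
      proof cases
        case 1
        then show ?thesis using step.IH V by auto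
      next
        case 2
        then show ?thesis using step.IH by auto
      next
        case 3
        then have "(v, w) \<in> R'" using step.hyps by (auto simp: R'_def)
        then show ?thesis using 3 step.IH by (auto intro: rtrancl_into_rtrancl)
      qed
    qed
    moreover have "R'\<^sup>* \<subseteq> R\<^sup>*"
      by (rule rtrancl_mono) (auto simp: R'_def)
    ultimately show ?thesis
      using that not_into_x by (auto simp: C_def C'_def)
  qed
  have "?V = insert x (?V - {x})" using V by auto
  then have "C ` ?V = insert (C x) (C ` (?V - {x}))"
    by (metis image_insert)
  also have "C x = C y" using xy by (intro C_eq) auto
  finally have CV: "C ` ?V = C ` (?V - {x})" using V by auto
  have "C' ` ?V = insert (C' x) (C' ` (?V - {x}))"
    using \<open>?V = insert x (?V - {x})\<close> by (metis image_insert)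
  also have "C' ` (?V - {x}) = ?del ` C ` (?V - {x})"
    unfolding image_image using C'_other by (intro image_cong) auto
  finally have C'V: "C' ` ?V = insert {x} (?del ` C ` ?V)"
    by (simp only: CV C'_x)
  \<comment> \<open>By \<open>CV\<close> every component has a representative other than
    \<open>x\<close>. It survives the removal of \<open>x\<close> and still determines the
    component.\<close>
  have inj: "inj_on ?del (C ` ?V)"
    unfolding CV
  proof (rule inj_onI)
    fix S T assume ST: "S \<in> C ` (?V - {x})" "T \<in> C ` (?V - {x})" "S - {x} = T - {x}"
    then obtain u v where "u \<noteq> x" "S = C u" "T = C v" by auto
    moreover from this ST(3) have "u \<in> C v" by (auto simp: C_def)
    ultimately show "S = T" using C_eq[of v u] by (auto simp: C_def)
  qed
  have "card (C' ` ?V) = Suc (card (?del ` C ` ?V))"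
    \<comment> \<open>The set \<open>{x}\<close> is new because no set in the image of
      \<open>?del\<close> contains \<open>x\<close>.\<close>
    unfolding C'V using pair_finite_verts by (intro card_insert_disjoint) auto
  also have "\<dots> = card (C ` ?V) + 1"
    using card_image[OF inj] by simp
  finally show ?thesis
    using assms(1) xy
    by (simp add: cut_edge_def num_components_conv_rtrancl pair_graph_del_edge
        C_def C'_def R_def R'_def)
qed

section \<open>Powers and inverses in a finite group\<close>

definition (in group) is_power :: "'a \<Rightarrow> 'a \<Rightarrow> bool" where
  "is_power x y \<longleftrightarrow> (\<exists>m::nat. m > 0 \<and> y = x [^] m)"

context group
begin

lemma is_power_trans:
  assumes "x \<in> carrier G" "is_power x y" "is_power y z"
  shows "is_power x z"
  using assms by (auto simp: is_power_def nat_pow_pow) (metis nat_0_less_mult_iff)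

lemma is_power_inv:
  assumes "finite (carrier G)" "x \<in> carrier G"
  shows "is_power x (inv x)"
proof -
  \<comment> \<open>The factor 2 keeps the exponent positive in the trivial group, where
    \<open>order G - 1\<close> is 0.\<close>
  have "x [^] (2 * order G - 1) \<otimes> x = x [^] (2 * order G)"
    using assms order_gt_0_iff_finite by (metis One_nat_def Suc_diff_1 nat_0_less_mult_iff
      nat_pow_Suc zero_less_numeral)
  also have "\<dots> = \<one>"
    using assms by (simp add: pow_order_eq_1 mult.commute flip: nat_pow_pow)
  finally have "inv x = x [^] (2 * order G - 1)"
    using assms by (simp add: inv_equality)
  moreover have "2 * order G - 1 > 0"
    using assms order_gt_0_iff_finite by simp
  ultimately show ?thesis unfolding is_power_def by blast
qed

lemma is_power_inv_left:
  assumes "finite (carrier G)" "x \<in> carrier G"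
  shows "is_power (inv x) x"
  using is_power_inv[of "inv x"] assms by simp

text \<open>Each of \<open>x\<close> and \<open>inv x\<close> is a power of the other, so
  transitivity makes them interchangeable. This is the source of the triangles in the main
  argument.\<close>

lemma is_power_inv_iff:
  assumes "finite (carrier G)" "x \<in> carrier G" "y \<in> carrier G"
  shows "is_power (inv x) y \<longleftrightarrow> is_power x y" "is_power y (inv x) \<longleftrightarrow> is_power y x"
  using assms is_power_inv is_power_inv_left is_power_trans inv_closed by blast+

lemma involution_is_power:
  assumes "x \<in> carrier G" "inv x = x" "is_power x y"
  shows "y = x \<or> y = \<one>"
proof -
  have sq: "x \<otimes> x = \<one>" using assms r_inv by metis
  have "x [^] m = x \<or> x [^] m = \<one>" for m :: nat
    using assms(1) sq by (induction m) auto
  then show ?thesis using assms by (auto simp: is_power_def)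
qed

lemma parcs_proper_power_graph_iff:
  "(x, y) \<in> parcs (proper_power_graph G) \<longleftrightarrow>
     x \<in> carrier G - {\<one>} \<and> y \<in> carrier G - {\<one>} \<and> x \<noteq> y \<and> (is_power x y \<or> is_power y x)"
  by (auto simp: proper_power_graph_def is_power_def)

lemma out_arcs_proper_power_digraph:
  assumes "x \<in> carrier G - {\<one>}"
  shows "out_arcs (with_proj (proper_power_digraph G)) x =
    Pair x ` {y \<in> carrier G - {\<one>, x}. is_power x y}"
  using assms by (auto simp: out_arcs_def proper_power_digraph_def is_power_def image_iff)

lemma in_arcs_proper_power_digraph:
  assumes "x \<in> carrier G - {\<one>}"
  shows "in_arcs (with_proj (proper_power_digraph G)) x =
    (\<lambda>y. (y, x)) ` {y \<in> carrier G - {\<one>, x}. is_power y x}"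
  using assms by (auto simp: in_arcs_def proper_power_digraph_def is_power_def image_iff)

lemma inv_neq_if_adjacent:
  assumes "(x, y) \<in> parcs (proper_power_graph G)" "is_power x y"
  shows "inv x \<noteq> x"
  using assms involution_is_power by (auto simp: parcs_proper_power_graph_iff)

end

theorem theorem6:
  fixes G (structure) and x y :: 'a
  assumes "group G"
    and "finite (carrier G)"
    and "(x, y) \<in> parcs (proper_power_graph G)"
  shows "cut_edge (proper_power_graph G) x y \<longleftrightarrow>
           in_degree (with_proj (proper_power_digraph G)) x = 1
         \<and> out_degree (with_proj (proper_power_digraph G)) x = 1"
proof -
  interpret group G by fact
  note fin = assms(2)
  let ?\<Gamma> = "proper_power_graph G"
  let ?In = "{u \<in> carrier G - {\<one>, x}. is_power u x}"
  let ?Out = "{u \<in> carrier G - {\<one>, x}. is_power x u}"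
  have pg: "pair_graph ?\<Gamma>"
    using fin by (rule pair_graph_proper_power_graph)
  then interpret pg: pair_graph ?\<Gamma> .
  have xy: "x \<in> carrier G" "x \<noteq> \<one>" "y \<in> carrier G" "y \<noteq> \<one>" "x \<noteq> y"
    "is_power x y \<or> is_power y x"
    using assms(3) by (auto simp: parcs_proper_power_graph_iff)
  have in_deg: "in_degree (with_proj (proper_power_digraph G)) x = card ?In"
    using xy unfolding in_degree_def
    by (subst in_arcs_proper_power_digraph) (auto intro!: card_image inj_onI)
  have out_deg: "out_degree (with_proj (proper_power_digraph G)) x = card ?Out"
    using xy unfolding out_degree_def
    by (subst out_arcs_proper_power_digraph) (auto intro!: card_image inj_onI)
  have inv_mem: "inv x \<in> ?In" "inv x \<in> ?Out" if "inv x \<noteq> x"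
    using that xy fin is_power_inv is_power_inv_left by (auto simp: inv_eq_1_iff)
  show ?thesis
  proof
    assume cut: "cut_edge ?\<Gamma> x y"
    have no_triangle: "(x, z) \<notin> parcs ?\<Gamma> \<or> (z, y) \<notin> parcs ?\<Gamma>" for z
      using cut not_cut_edge_triangle[OF pg assms(3)] by blast
    have y: "y = inv x"
    proof (rule ccontr)
      assume neq: "y \<noteq> inv x"
      \<comment> \<open>The end that has the other end among its powers is not its own inverse; for
        \<open>y\<close> the edge is first reversed.\<close>
      consider "inv x \<noteq> x" | "inv y \<noteq> y"
        using xy assms(3) inv_neq_if_adjacent pg.arcs_symmetric by blast
      then show False
      proof cases
        case 1
        then show False
          using no_triangle[of "inv x"] xy neq fin is_power_inv
          by (auto simp: parcs_proper_power_graph_iff is_power_inv_iff)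
      next
        case 2
        moreover have "inv y \<noteq> x" using neq xy by auto
        ultimately show False
          using no_triangle[of "inv y"] xy neq fin is_power_inv
          by (auto simp: parcs_proper_power_graph_iff is_power_inv_iff)
      qed
    qed
    \<comment> \<open>Any other neighbour \<open>u\<close> of \<open>x\<close> would also be
      adjacent to \<open>inv x\<close>, which is \<open>y\<close>, and would close a triangle on the
      cut edge.\<close>
    have nb: "u = inv x" if "u \<in> carrier G" "u \<noteq> \<one>" "u \<noteq> x" "is_power u x \<or> is_power x u" for u
      using no_triangle[of u] that xy y fin
      by (auto simp: parcs_proper_power_graph_iff is_power_inv_iff)
    have "?In = {inv x}" "?Out = {inv x}"
      using nb inv_mem xy(5) y by auto
    then show "in_degree (with_proj (proper_power_digraph G)) x = 1 \<and>
        out_degree (with_proj (proper_power_digraph G)) x = 1"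
      unfolding in_deg out_deg by simp
  next
    assume "in_degree (with_proj (proper_power_digraph G)) x = 1 \<and>
        out_degree (with_proj (proper_power_digraph G)) x = 1"
    then obtain a b where ab: "?In = {a}" "?Out = {b}"
      unfolding in_deg out_deg by (auto simp: card_1_singleton_iff)
    \<comment> \<open>An out-neighbour is a power of \<open>x\<close> other than \<open>x\<close>
      and \<open>\<one>\<close>, which rules out \<open>inv x = x\<close>. Both singletons must then
      consist of \<open>inv x\<close>.\<close>
    then have "b \<in> ?Out" by blast
    then have "inv x \<noteq> x"
      using xy involution_is_power by blast
    from inv_mem[OF this] have "?In = {inv x}" "?Out = {inv x}"
      unfolding ab by (simp_all only: singleton_iff)
    then have nb: "(x, v) \<in> parcs ?\<Gamma> \<Longrightarrow> v = inv x" for v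
      by (auto simp: parcs_proper_power_graph_iff)
    show "cut_edge ?\<Gamma> x y"
      \<comment> \<open>The given edge supplies the missing direction: \<open>y\<close> is a
        neighbour of \<open>x\<close>, hence equals \<open>inv x\<close>, the only possible
        one.\<close>
      using nb assms(3) by (intro cut_edge_pendant[OF pg]) blast
  qed
qed

end
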